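(* For all integers $n\ge0$ and $r\ge0$, the expected value of $X_{n+1,r}$ is $$\mathbb{E}X_{n+1,r}=\frac1{C_n}\sum_{\ell\ge1}\biggl(\binom{2n}{n+1-\ell(r+1)}-\binom{2n}{n-\ell(r+1)}\biggr).$$
   Context: A plane tree is a finite rooted tree in which the children of every node are linearly ordered; its size is its number of nodes. A leaf is a node without children (the single-node tree consists of one leaf). For a plane tree $\tau$ with at least two nodes, $\rho(\tau)$ is obtained by simultaneously deleting all leaves of $\tau$; $\rho$ is not defined on the single-node tree. $X_{n,r}$ is the size of $\rho^r(\tau)$, where $\tau$ is chosen uniformly at random among all plane trees of size $n$; if $\rho^r(\tau)$ is not defined, then $X_{n,r}=0$. $C_n=\frac1{n+1}\binom{2n}n$. Binomial coefficients $\binom mk$ with $k<0$ are $0$. *)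

theory Defs
  imports "HOL-Probability.Probability"
begin

datatype plane_tree = Node "plane_tree list"

text \<open>The number of nodes (not the generated size function of the datatype, which counts list
  constructors as well).\<close>

fun nodes :: "plane_tree \<Rightarrow> nat" where
  "nodes (Node ts) = Suc (\<Sum>t\<leftarrow>ts. nodes t)"

fun is_leaf :: "plane_tree \<Rightarrow> bool" where
  "is_leaf (Node ts) \<longleftrightarrow> ts = []"

text \<open>Deletes all leaves strictly below the root; a node that becomes a leaf in the process is kept.\<close>

fun delete_leaves :: "plane_tree \<Rightarrow> plane_tree" where
  "delete_leaves (Node ts) = Node (map delete_leaves (filter (\<lambda>t. \<not> is_leaf t) ts))"

definition rho :: "plane_tree \<Rightarrow> plane_tree option" where
  "rho t = (if is_leaf t then None else Some (delete_leaves t))"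

primrec rho_iter :: "nat \<Rightarrow> plane_tree \<Rightarrow> plane_tree option" where
  "rho_iter 0 t = Some t"
| "rho_iter (Suc r) t = Option.bind (rho_iter r t) rho"

definition reduced_size :: "nat \<Rightarrow> plane_tree \<Rightarrow> nat" where
  "reduced_size r t = (case rho_iter r t of None \<Rightarrow> 0 | Some t' \<Rightarrow> nodes t')"

definition plane_trees :: "nat \<Rightarrow> plane_tree set" where
  "plane_trees n = {t. nodes t = n}"

text \<open>\<^const>\<open>pmf_of_set\<close> is the uniform distribution only on finite nonempty sets.\<close>

lemma nodes_pos: "nodes t > 0"
  by (cases t) simp

lemma finite_plane_trees_le: "finite {t. nodes t \<le> n}"
proof (induction n)
  case 0
  have "{t. nodes t \<le> 0} = {}"
    by (simp add: nodes_pos)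
  then show ?case by (simp only: finite.emptyI)
next
  case (Suc n)
  have "{t. nodes t \<le> Suc n} \<subseteq> Node ` {ts. set ts \<subseteq> {t. nodes t \<le> n} \<and> length ts \<le> n}"
  proof
    fix t assume "t \<in> {t. nodes t \<le> Suc n}"
    then obtain ts where t: "t = Node ts" and sum: "(\<Sum>t\<leftarrow>ts. nodes t) \<le> n"
      by (cases t) auto
    have "set ts \<subseteq> {t. nodes t \<le> n}"
    proof
      fix u assume "u \<in> set ts"
      then have "nodes u \<le> (\<Sum>t\<leftarrow>ts. nodes t)"
        by (intro member_le_sum_list) simp_all
      with sum show "u \<in> {t. nodes t \<le> n}" by simp
    qed
    moreover have "length ts \<le> (\<Sum>t\<leftarrow>ts. nodes t)"
    proof (induction ts)
      case (Cons u us)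
      then show ?case using nodes_pos[of u] by simp
    qed simp
    with sum have "length ts \<le> n" by linarith
    ultimately show "t \<in> Node ` {ts. set ts \<subseteq> {t. nodes t \<le> n} \<and> length ts \<le> n}"
      using t sum by auto
  qed
  then show ?case
    by (rule finite_subset) (intro finite_imageI finite_lists_length_le Suc.IH)
qed

lemma finite_plane_trees: "finite (plane_trees n)"
  by (rule finite_subset[OF _ finite_plane_trees_le[of n]]) (auto simp: plane_trees_def)

lemma nodes_star: "nodes (Node (replicate n (Node []))) = Suc n"
  by (simp add: sum_list_replicate)

lemma plane_trees_nonempty: "plane_trees (Suc n) \<noteq> {}"
  using nodes_star[of n] unfolding plane_trees_def by blast

definition catalan :: "nat \<Rightarrow> real" where
  "catalan n = 1 / (real n + 1) * real ((2 * n) choose n)"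

definition int_choose :: "nat \<Rightarrow> int \<Rightarrow> nat" (infixl "ichoose" 64) where
  "m ichoose k = (if k < 0 then 0 else m choose nat k)"

text \<open>The infinite sum over \<open>l \<ge> 1\<close> in the main result has only finitely many nonzero terms,
  so summability is not an issue.\<close>

lemma summable_ichoose_diff:
  fixes n r :: nat
  shows "(\<lambda>l::nat. real ((2 * n) ichoose (int n + 1 - int l * (int r + 1)))
                   - real ((2 * n) ichoose (int n - int l * (int r + 1)))) summable_on {1..}"
    (is "?f summable_on _")
proof -
  have "?f l = 0" if "l \<in> {1..} - {1..n + 1}" for l
  proof -
    from that have "int n + 1 < int l" by auto
    moreover have "int l * 1 \<le> int l * (int r + 1)" by (rule mult_left_mono) auto
    ultimately have "int n + 1 < int l * (int r + 1)" by linarith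
    then show ?thesis by (simp add: int_choose_def)
  qed
  then have "?f summable_on {1..} \<longleftrightarrow> ?f summable_on {1..n + 1}"
    by (intro summable_on_cong_neutral) auto
  then show ?thesis by simp
qed

end

theory Submission
  imports Defs "HOL-Computational_Algebra.Formal_Power_Series"
begin

text \<open>A node survives \<open>r\<close> rounds of leaf deletion exactly if the subtree below it has height at least
  \<open>r\<close>, so \<open>X_{n+1,r}\<close> is the number of such nodes (\<open>reduced_size_eq_tall_nodes\<close>). These nodes are
  counted over all trees with \<open>n\<close> edges by generating functions in which \<open>z\<close> marks edges.

  A tree with at least one edge is the same as a pair of trees: the subtree at the first child of
  the root, and what remains without it. One edge is lost, so with \<open>C\<close> the series of all trees,
  \<open>L_r\<close> that of the trees of height less than \<open>r\<close>, and \<open>F_r\<close> that of the tall nodes,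
    \<open>C = 1 + z C\<^sup>2\<close>,  \<open>L_{r+1} = 1 + z L_r L_{r+1}\<close>,  \<open>F_r = 2 z C F_r - z C (C - L_r) + (C - L_r)\<close>.
  All of these become rational in \<open>u = C - 1\<close>, since \<open>z = u / (1 + u)\<^sup>2\<close>:
    \<open>L_r = C (1 - u^r) / (1 - u^{r+1})\<close>  and  \<open>F_r = C u^r / (1 - u^{r+1})\<close>
  (\<open>short_gf_closed\<close> and \<open>tall_nodes_gf_closed\<close>). The expansion of the geometric series turns \<open>F_r\<close>
  into the sum of \<open>C u^{l(r+1)-1}\<close> over \<open>l \<ge> 1\<close>. The coefficient of \<open>z^n\<close> in \<open>C u^{k-1}\<close> is the ballot
  number \<open>binom(2n, n+1-k) - binom(2n, n-k)\<close> (\<open>Cat_U_power_nth\<close>): both sides satisfy the recurrence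
  that expresses two steps in Pascal's triangle, which for the series is \<open>u = z (1 + u)\<^sup>2\<close>. The case
  \<open>k = 1\<close> says that there are \<open>C_n\<close> trees, and division by this number gives the expectation.\<close>

unbundle no vec_syntax
unbundle fps_syntax

section \<open>Repeated leaf deletion counts nodes of large height\<close>

text \<open>The height of the tree is at least \<open>r\<close>. The recursion on \<open>r\<close> matches the one for leaf deletion,
  which lowers all heights by one.\<close>

primrec tall :: "nat \<Rightarrow> plane_tree \<Rightarrow> bool" where
  "tall 0 t \<longleftrightarrow> True"
| "tall (Suc r) t \<longleftrightarrow> (case t of Node ts \<Rightarrow> \<exists>s\<in>set ts. tall r s)"

fun tall_nodes :: "nat \<Rightarrow> plane_tree \<Rightarrow> nat" where
  "tall_nodes r (Node ts) = of_bool (tall r (Node ts)) + (\<Sum>t\<leftarrow>ts. tall_nodes r t)"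

lemma is_leaf_iff: "is_leaf t \<longleftrightarrow> t = Node []"
  by (cases t) simp

lemma tall_delete_leaves:
  "\<not> is_leaf t \<Longrightarrow> tall r (delete_leaves t) \<longleftrightarrow> tall (Suc r) t"
proof (induction r arbitrary: t)
  case 0
  then show ?case by (cases t) (auto simp: neq_Nil_conv)
next
  case (Suc r)
  obtain ts where t: "t = Node ts" by (cases t)
  have "(\<exists>s\<in>set ts. \<not> is_leaf s \<and> tall r (delete_leaves s)) \<longleftrightarrow> (\<exists>s\<in>set ts. tall (Suc r) s)"
  proof (rule bex_cong[OF refl])
    fix s
    show "\<not> is_leaf s \<and> tall r (delete_leaves s) \<longleftrightarrow> tall (Suc r) s"
      using Suc.IH[of s] by (cases "is_leaf s") (simp_all add: is_leaf_iff)
  qed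
  then show ?case by (auto simp: t)
qed

text \<open>Deletion lowers the height of every surviving node by one, and the nodes that disappear have
  height \<open>0\<close>, so they were not counted on the right.\<close>

lemma tall_nodes_delete_leaves:
  "\<not> is_leaf t \<Longrightarrow> tall_nodes r (delete_leaves t) = tall_nodes (Suc r) t"
proof (induction t)
  case (Node ts)
  have "(\<Sum>s\<leftarrow>filter (\<lambda>s. \<not> is_leaf s) ts. tall_nodes r (delete_leaves s)) =
      (\<Sum>s\<leftarrow>ts. tall_nodes (Suc r) s)"
    using Node.IH
  proof (induction ts)
    case (Cons s ss)
    then show ?case by (cases "is_leaf s") (simp_all add: is_leaf_iff)
  qed simp
  then show ?case
    using tall_delete_leaves[OF Node.prems, of r] by (simp add: o_def)
qed

text \<open>The iteration applies its additional step last; the comparison with \<^const>\<open>tall_nodes\<close>, where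
  one deletion lowers the height bound by one, needs it first.\<close>

lemma rho_iter_Suc_left: "rho_iter (Suc r) t = Option.bind (rho t) (rho_iter r)"
proof (induction r)
  case 0
  then show ?case by (cases "rho t") auto
next
  case (Suc r)
  have "rho_iter (Suc (Suc r)) t = Option.bind (Option.bind (rho t) (rho_iter r)) rho"
    by (simp only: rho_iter.simps(2)[of "Suc r"] Suc)
  also have "\<dots> = Option.bind (rho t) (rho_iter (Suc r))"
    by (cases "rho t") auto
  finally show ?case .
qed

lemma tall_nodes_0: "tall_nodes 0 t = nodes t"
  by (induction t) (auto cong: map_cong)

lemma reduced_size_eq_tall_nodes: "reduced_size r t = tall_nodes r t"
proof (induction r arbitrary: t)
  case 0
  then show ?case by (simp add: reduced_size_def tall_nodes_0)
next
  case (Suc r)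
  show ?case
  proof (cases "is_leaf t")
    case True
    then show ?thesis
      unfolding reduced_size_def rho_iter_Suc_left by (simp add: rho_def is_leaf_iff)
  next
    case False
    then have "reduced_size (Suc r) t = reduced_size r (delete_leaves t)"
      unfolding reduced_size_def rho_iter_Suc_left by (simp add: rho_def)
    then show ?thesis
      by (simp only: Suc.IH tall_nodes_delete_leaves[OF False])
  qed
qed

section \<open>Generating functions of weighted plane trees\<close>

text \<open>The index is the number of edges, one less than the number of nodes, because edges are what
  behaves additively (up to the one new edge) when a tree is grafted.\<close>

definition tree_gf :: "(plane_tree \<Rightarrow> real) \<Rightarrow> real fps" where
  "tree_gf w = Abs_fps (\<lambda>n. \<Sum>t\<in>plane_trees (Suc n). w t)"

text \<open>The weight of a tree with at least one edge that is multiplicative for its decomposition into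
  the subtree at the first child of the root and the rest, which keeps the root.\<close>

fun graft_weight :: "(plane_tree \<Rightarrow> real) \<Rightarrow> (plane_tree \<Rightarrow> real) \<Rightarrow> plane_tree \<Rightarrow> real" where
  "graft_weight f g (Node []) = 0"
| "graft_weight f g (Node (t # ts)) = f t * g (Node ts)"

lemma tree_gf_add: "tree_gf (\<lambda>t. f t + g t) = tree_gf f + tree_gf g"
  by (rule fps_ext) (simp add: tree_gf_def sum.distrib)

lemma tree_gf_diff: "tree_gf (\<lambda>t. f t - g t) = tree_gf f - tree_gf g"
  by (rule fps_ext) (simp add: tree_gf_def sum_subtractf)

lemma sum_list_nodes_eq_0_iff: "(\<Sum>t\<leftarrow>ts. nodes t) = 0 \<longleftrightarrow> ts = []"
proof (cases ts)
  case (Cons t us)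
  then show ?thesis using nodes_pos[of t] by simp
qed simp

lemma plane_trees_1: "plane_trees (Suc 0) = {Node []}"
proof -
  have "nodes t = Suc 0 \<longleftrightarrow> t = Node []" for t
    by (cases t) (simp only: nodes.simps nat.inject sum_list_nodes_eq_0_iff plane_tree.inject)
  then show ?thesis by (auto simp: plane_trees_def)
qed

lemma tree_gf_leaf: "tree_gf (\<lambda>t. of_bool (is_leaf t)) = 1"
proof (rule fps_ext)
  fix n
  show "tree_gf (\<lambda>t. of_bool (is_leaf t)) $ n = 1 $ n"
  proof (cases n)
    case 0
    then show ?thesis by (simp add: tree_gf_def plane_trees_1)
  next
    case (Suc m)
    then have "\<not> is_leaf t" if "t \<in> plane_trees (Suc n)" for t
      using that by (auto simp: plane_trees_def is_leaf_iff)
    then show ?thesis using Suc by (simp add: tree_gf_def)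
  qed
qed

text \<open>The decomposition at the first child is a bijection onto pairs of trees; it removes the edge
  from the root to this child, which the factor \<open>fps_X\<close> restores.\<close>

lemma tree_gf_graft_weight:
  "tree_gf (graft_weight f g) = fps_X * (tree_gf f * tree_gf g)"
proof (rule fps_ext)
  fix n
  show "tree_gf (graft_weight f g) $ n = (fps_X * (tree_gf f * tree_gf g)) $ n"
  proof (cases n)
    case 0
    then show ?thesis by (simp add: tree_gf_def plane_trees_1)
  next
    case (Suc m)
    define pairs where
      "pairs = (SIGMA i:{0..m}. plane_trees (Suc i) \<times> plane_trees (Suc (m - i)))"
    have "(tree_gf f * tree_gf g) $ m =
        (\<Sum>i=0..m. \<Sum>p\<in>plane_trees (Suc i) \<times> plane_trees (Suc (m - i)). f (fst p) * g (snd p))"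
      by (simp add: fps_mult_nth tree_gf_def sum_product sum.cartesian_product split_beta)
    also have "\<dots> = (\<Sum>(i, t, s)\<in>pairs. f t * g s)"
      unfolding pairs_def by (subst sum.Sigma) (auto simp: finite_plane_trees split_beta)
    also have "\<dots> = (\<Sum>t\<in>plane_trees (Suc n). graft_weight f g t)"
    \<comment> \<open>the index \<open>i\<close> is the number of edges of the first subtree, hence \<open>nodes - 1\<close>\<close>
    proof (rule sum.reindex_bij_witness[where
          i = "\<lambda>t. case t of Node us \<Rightarrow> (nodes (hd us) - 1, hd us, Node (tl us))" and
          j = "\<lambda>(i, t, s). case s of Node us \<Rightarrow> Node (t # us)"])
      fix t assume t: "t \<in> plane_trees (Suc n)"
      with Suc obtain u us where us: "t = Node (u # us)" "nodes u + nodes (Node us) = Suc (Suc m)"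
        by (cases t, rename_tac vs, case_tac vs) (auto simp: plane_trees_def)
      show "(case t of Node us \<Rightarrow> (nodes (hd us) - 1, hd us, Node (tl us))) \<in> pairs"
        using us nodes_pos[of u] by (auto simp: pairs_def plane_trees_def)
      show "(case case t of Node us \<Rightarrow> (nodes (hd us) - 1, hd us, Node (tl us)) of
          (i, t, s) \<Rightarrow> case s of Node us \<Rightarrow> Node (t # us)) = t"
        using us by simp
    next
      fix p assume "p \<in> pairs"
      then obtain i t us where p: "p = (i, t, Node us)" "nodes t = Suc i"
          "nodes (Node us) = Suc (m - i)" "i \<le> m"
        by (cases p, rename_tac i t s, case_tac s) (auto simp: pairs_def plane_trees_def)
      show "(case case p of (i, t, s) \<Rightarrow> case s of Node us \<Rightarrow> Node (t # us) of
          Node us \<Rightarrow> (nodes (hd us) - 1, hd us, Node (tl us))) = p"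
        using p by simp
      show "(case p of (i, t, s) \<Rightarrow> case s of Node us \<Rightarrow> Node (t # us)) \<in> plane_trees (Suc n)"
        using p Suc by (simp add: plane_trees_def)
      show "graft_weight f g (case p of (i, t, s) \<Rightarrow> case s of Node us \<Rightarrow> Node (t # us)) =
          (case p of (i, t, s) \<Rightarrow> f t * g s)"
        using p by simp
    qed
    finally show ?thesis using Suc by (simp add: tree_gf_def)
  qed
qed

section \<open>Trees of bounded height and the total number of tall nodes\<close>

definition Cat :: "real fps" where
  "Cat = tree_gf (\<lambda>t. 1)"

text \<open>The parameter in which all series below are rational; it inverts \<open>u / (1 + u)\<^sup>2\<close>.\<close>

definition U :: "real fps" where
  "U = Cat - 1"

lemma Cat_eq: "Cat = 1 + fps_X * Cat ^ 2"
proof -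
  have "(\<lambda>t. 1) = (\<lambda>t. of_bool (is_leaf t) + graft_weight (\<lambda>t. 1) (\<lambda>t. 1) t)"
  proof
    fix t show "1 = of_bool (is_leaf t) + graft_weight (\<lambda>t. 1) (\<lambda>t. 1) t"
      by (cases t rule: is_leaf.cases, rename_tac ts, case_tac ts) auto
  qed
  then have "Cat = tree_gf (\<lambda>t. of_bool (is_leaf t) + graft_weight (\<lambda>t. 1) (\<lambda>t. 1) t)"
    unfolding Cat_def by (rule arg_cong)
  then show ?thesis
    by (simp only: tree_gf_add tree_gf_leaf tree_gf_graft_weight Cat_def[symmetric] power2_eq_square)
qed

lemma Cat_eq_U: "Cat = 1 + U"
  by (simp add: U_def)

lemma U_eq: "U = fps_X * Cat ^ 2"
  unfolding U_def by (subst Cat_eq) simp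

lemma U_nth_0 [simp]: "U $ 0 = 0"
  by (simp add: U_eq)

definition short_gf :: "nat \<Rightarrow> real fps" where
  "short_gf r = tree_gf (\<lambda>t. of_bool (\<not> tall r t))"

lemma short_gf_0: "short_gf 0 = 0"
  by (rule fps_ext) (simp add: short_gf_def tree_gf_def)

text \<open>A tree has height at most \<open>r\<close> exactly if the subtree at its first child has height less than
  \<open>r\<close> and the remaining tree has height at most \<open>r\<close>.\<close>

lemma short_gf_Suc: "short_gf (Suc r) = 1 + fps_X * (short_gf r * short_gf (Suc r))"
proof -
  let ?f = "\<lambda>r t. of_bool (\<not> tall r t)"
  have "?f (Suc r) = (\<lambda>t. of_bool (is_leaf t) + graft_weight (?f r) (?f (Suc r)) t)"
  proof
    fix t show "?f (Suc r) t = of_bool (is_leaf t) + graft_weight (?f r) (?f (Suc r)) t"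
      by (cases t, rename_tac ts, case_tac ts) auto
  qed
  then have "short_gf (Suc r) =
      tree_gf (\<lambda>t. of_bool (is_leaf t) + graft_weight (?f r) (?f (Suc r)) t)"
    unfolding short_gf_def by (rule arg_cong)
  then show ?thesis
    by (simp only: tree_gf_add tree_gf_leaf tree_gf_graft_weight short_gf_def[symmetric])
qed

text \<open>The denominators are multiplied out. Writing \<open>u\<close> for \<^const>\<open>U\<close>, the recurrence turns the closed
  form for \<open>r\<close> into that for \<open>r + 1\<close> because of
  \<open>C (1 - u^{r+1}) - z C\<^sup>2 (1 - u^r) = (1 + u) (1 - u^{r+1}) - u (1 - u^r) = 1 - u^{r+2}\<close>.\<close>

lemma short_gf_closed: "short_gf r * (1 - U ^ (r + 1)) = Cat * (1 - U ^ r)"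
proof (induction r)
  case 0
  then show ?case by (simp add: short_gf_0)
next
  case (Suc r)
  have inner: "Cat * (1 - U ^ (r + 1)) - fps_X * Cat * (Cat * (1 - U ^ r)) = 1 - U ^ (r + 2)"
  proof -
    have "fps_X * Cat * (Cat * (1 - U ^ r)) = U * (1 - U ^ r)"
      by (simp add: U_eq power2_eq_square mult.assoc)
    then show ?thesis
      by (simp only: Cat_eq_U) (simp add: algebra_simps)
  qed
  have step: "short_gf (Suc r) * (1 - fps_X * short_gf r) = 1"
    using short_gf_Suc[of r] by (simp add: algebra_simps)
  have "short_gf (Suc r) * (1 - U ^ (r + 2)) =
      short_gf (Suc r) * (Cat * (1 - U ^ (r + 1)) - fps_X * Cat * (short_gf r * (1 - U ^ (r + 1))))"
    by (simp only: inner Suc.IH)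
  also have "\<dots> = Cat * (1 - U ^ (r + 1)) * (short_gf (Suc r) * (1 - fps_X * short_gf r))"
    by (simp add: algebra_simps)
  finally show ?case by (simp add: step)
qed

definition tall_nodes_gf :: "nat \<Rightarrow> real fps" where
  "tall_nodes_gf r = tree_gf (\<lambda>t. real (tall_nodes r t))"

text \<open>The tall nodes of a tree are those of the first subtree and those of the remaining tree, except
  that the root has to be judged by the whole tree: its contribution within the remaining tree is
  subtracted and its contribution in the whole tree is added.\<close>

lemma tall_nodes_gf_rec:
  "tall_nodes_gf r * (1 - 2 * (fps_X * Cat)) = (Cat - short_gf r) * (1 - fps_X * Cat)"
proof -
  let ?w = "\<lambda>t. real (tall_nodes r t)"
  let ?h = "\<lambda>t. 1 - of_bool (\<not> tall r t) :: real"
  let ?one = "\<lambda>t. 1 :: real"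
  have h: "tree_gf ?h = Cat - short_gf r"
    by (simp only: tree_gf_diff Cat_def short_gf_def)
  have "?w = (\<lambda>t. graft_weight ?w ?one t + graft_weight ?one ?w t - graft_weight ?one ?h t + ?h t)"
  proof
    fix t
    show "?w t = graft_weight ?w ?one t + graft_weight ?one ?w t - graft_weight ?one ?h t + ?h t"
      by (cases t, rename_tac ts, case_tac ts) auto
  qed
  then have "tall_nodes_gf r = tree_gf
      (\<lambda>t. graft_weight ?w ?one t + graft_weight ?one ?w t - graft_weight ?one ?h t + ?h t)"
    unfolding tall_nodes_gf_def by (rule arg_cong)
  also have "\<dots> = fps_X * (tall_nodes_gf r * Cat) + fps_X * (Cat * tall_nodes_gf r)
      - fps_X * (Cat * (Cat - short_gf r)) + (Cat - short_gf r)"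
    unfolding tree_gf_add tree_gf_diff[of "\<lambda>t. graft_weight ?w ?one t + graft_weight ?one ?w t"]
      tree_gf_graft_weight h
    by (simp only: tall_nodes_gf_def Cat_def)
  finally show ?thesis by (simp add: algebra_simps)
qed

text \<open>Multiplied by \<^const>\<open>Cat\<close>, the recurrence reads \<open>F (1 - u) = C - L\<close>, and the right-hand side is known
  from the closed form for \<open>L\<close>; the factor \<open>1 - u\<close> cancels.\<close>

lemma tall_nodes_gf_closed: "tall_nodes_gf r * (1 - U ^ (r + 1)) = Cat * U ^ r"
proof -
  let ?F = "tall_nodes_gf r" and ?H = "Cat - short_gf r"
  have "?F * (Cat - 2 * U) = ?H * (Cat - U)"
    using arg_cong[OF tall_nodes_gf_rec[of r], of "\<lambda>x. x * Cat"]
    by (simp add: U_eq power2_eq_square algebra_simps)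
  then have F: "?F * (1 - U) = ?H"
    by (simp add: U_def algebra_simps)
  have "(1 - U) * (?F * (1 - U ^ (r + 1))) = ?H * (1 - U ^ (r + 1))"
    by (simp only: F[symmetric] mult_ac)
  also have "\<dots> = Cat * (1 - U ^ (r + 1)) - Cat * (1 - U ^ r)"
    by (simp only: left_diff_distrib short_gf_closed)
  also have "\<dots> = (1 - U) * (Cat * U ^ r)"
    by (simp add: algebra_simps)
  finally have "(1 - U) * (?F * (1 - U ^ (r + 1))) = (1 - U) * (Cat * U ^ r)" .
  moreover have "1 - U \<noteq> 0"
  proof
    assume "1 - U = 0"
    then have "(1 - U) $ 0 = 0" by simp
    then show False by simp
  qed
  ultimately show ?thesis by simp
qed

section \<open>Ballot numbers\<close>

definition ballot :: "nat \<Rightarrow> int \<Rightarrow> real" where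
  "ballot n k = real ((2 * n) ichoose (int n + 1 - k)) - real ((2 * n) ichoose (int n - k))"

lemma ichoose_Suc: "Suc m ichoose k = (m ichoose k) + (m ichoose (k - 1))"
proof (cases "k \<le> 0")
  case True
  then show ?thesis by (auto simp: int_choose_def)
next
  case False
  then have "nat k = Suc (nat (k - 1))" by simp
  with False show ?thesis by (simp add: int_choose_def)
qed

text \<open>Two applications of Pascal's rule, since the upper index \<open>2 n\<close> grows by two.\<close>

lemma ballot_Suc: "ballot (Suc n) k = ballot n (k - 1) + 2 * ballot n k + ballot n (k + 1)"
proof -
  have double: "2 * Suc n = Suc (Suc (2 * n))" by simp
  show ?thesis
    unfolding ballot_def double ichoose_Suc by (simp add: algebra_simps)
qed

lemma ichoose_symmetric: "m ichoose (int m - k) = m ichoose k"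
  by (auto simp: int_choose_def nat_diff_distrib binomial_symmetric[symmetric])

text \<open>The boundary value that closes the recurrence at \<open>k = 1\<close>.\<close>

lemma ballot_0_right: "ballot n 0 = - ballot n 1"
proof -
  have "(2 * n) ichoose (int n + 1) = (2 * n) ichoose (int n - 1)"
    using ichoose_symmetric[of "2 * n" "int n - 1"] by (simp add: algebra_simps)
  then show ?thesis by (simp add: ballot_def)
qed

lemma ballot_1: "ballot n 1 = catalan n"
proof (cases n)
  case 0
  then show ?thesis by (simp add: ballot_def catalan_def int_choose_def)
next
  case (Suc m)
  define a b where "a = (2 * n) choose Suc m" and "b = (2 * n) choose m"
  have "Suc m * a = (2 * n - m) * b"
    unfolding a_def b_def by (metis binomial_absorb_comp binomial_absorption)
  also have "2 * n - m = m + 2"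
    using Suc by simp
  finally have "real (Suc m * a) = real ((m + 2) * b)"
    by (rule arg_cong)
  then have "real a - real b = 1 / (real n + 1) * real a"
    using Suc by (simp add: field_simps)
  moreover have "ballot n 1 = real a - real b"
  proof -
    have ints: "int n + 1 - 1 = int (Suc m)" "int n - 1 = int m"
      using Suc by simp_all
    show ?thesis
      unfolding ballot_def ints a_def b_def
      by (simp add: int_choose_def del: of_nat_Suc binomial_Suc_Suc)
  qed
  moreover have "catalan n = 1 / (real n + 1) * real a"
    by (simp only: catalan_def a_def Suc)
  ultimately show ?thesis by simp
qed

text \<open>For \<open>k > 0\<close>, replacing one factor \<open>u\<close> by \<open>z (1 + u)\<^sup>2\<close> gives the recurrence of the ballot numbers. For
  \<open>k = 0\<close>, the equation \<open>C = 1 + z C (1 + u)\<close> gives it after the reflection \<open>ballot_0_right\<close>.\<close>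

lemma Cat_U_power_nth: "(Cat * U ^ k) $ n = ballot n (int k + 1)"
proof (induction n arbitrary: k)
  case 0
  have "Cat $ 0 = 1" by (subst Cat_eq) simp
  then show ?case by (cases k) (simp_all add: ballot_def int_choose_def)
next
  case (Suc n)
  show ?case
  proof (cases k)
    case 0
    have "Cat = 1 + fps_X * (Cat * U ^ 0 + Cat * U ^ 1)"
      using Cat_eq by (simp add: U_def power2_eq_square algebra_simps)
    then have "Cat $ Suc n = (1 + fps_X * (Cat * U ^ 0 + Cat * U ^ 1)) $ Suc n"
      by (rule arg_cong)
    also have "\<dots> = ballot n 1 + ballot n 2"
      using Suc[of 0] Suc[of 1] by simp
    finally show ?thesis
      using 0 by (simp add: ballot_Suc ballot_0_right)
  next
    case (Suc j)
    have "Cat * U ^ k = fps_X * (Cat * U ^ j + 2 * (Cat * U ^ (j + 1)) + Cat * U ^ (j + 2))"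
    proof -
      have "Cat * U ^ k = Cat * U ^ j * (fps_X * Cat ^ 2)"
        by (simp add: Suc U_eq[symmetric])
      also have "\<dots> = Cat * U ^ j * (fps_X * (1 + U) ^ 2)"
        by (simp add: Cat_eq_U)
      finally show ?thesis by (simp add: power2_eq_square algebra_simps)
    qed
    then have "(Cat * U ^ k) $ Suc n =
        (fps_X * (Cat * U ^ j + 2 * (Cat * U ^ (j + 1)) + Cat * U ^ (j + 2))) $ Suc n"
      by (rule arg_cong)
    also have "\<dots> = (Cat * U ^ j) $ n + 2 * (Cat * U ^ (j + 1)) $ n + (Cat * U ^ (j + 2)) $ n"
      by (simp only: fps_X_mult_nth fps_add_nth mult_2 nat.simps diff_Suc_1 if_False)
    also have "\<dots> = ballot (Suc n) (int k + 1)"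
      unfolding Suc.IH ballot_Suc by (simp add: Suc add_ac)
    finally show ?thesis .
  qed
qed

lemma card_plane_trees: "real (card (plane_trees (Suc n))) = catalan n"
  using Cat_U_power_nth[of 0 n] by (simp add: Cat_def tree_gf_def ballot_1)

text \<open>Powers of \<^const>\<open>U\<close> tend to zero as formal power series, which lets the geometric series terminate
  in each coefficient.\<close>

lemma U_power_mult_nth_eq_0:
  assumes "n < k" shows "(U ^ k * f) $ n = 0"
proof -
  have "U ^ k * f = fps_X ^ k * ((Cat ^ 2) ^ k * f)"
    by (simp only: U_eq power_mult_distrib mult.assoc)
  then show ?thesis using assms by (simp only: fps_X_power_mult_nth if_True)
qed

lemma sum_tall_nodes:
  "(\<Sum>t\<in>plane_trees (Suc n). real (tall_nodes r t)) =
    (\<Sum>l=1..Suc n. ballot n (int l * (int r + 1)))"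
proof -
  let ?F = "tall_nodes_gf r"
  have F: "?F = Cat * U ^ r + U ^ (r + 1) * ?F"
    using tall_nodes_gf_closed[of r] by (simp add: algebra_simps)
  \<comment> \<open>the geometric series with ratio \<open>U ^ (r + 1)\<close>, with its remainder\<close>
  have iter: "?F = (\<Sum>l<N. Cat * U ^ (l * (r + 1) + r)) + U ^ (N * (r + 1)) * ?F" for N
  proof (induction N)
    case (Suc N)
    have "U ^ (N * (r + 1)) * ?F =
        Cat * U ^ (N * (r + 1) + r) + U ^ (Suc N * (r + 1)) * ?F"
      by (subst F) (simp add: power_add algebra_simps)
    with Suc show ?case by (simp add: add.assoc)
  qed simp
  have "?F $ n = (\<Sum>l<Suc n. (Cat * U ^ (l * (r + 1) + r)) $ n) + (U ^ (Suc n * (r + 1)) * ?F) $ n"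
    by (subst iter[of "Suc n"]) (simp add: fps_sum_nth)
  also have "(U ^ (Suc n * (r + 1)) * ?F) $ n = 0"
    by (rule U_power_mult_nth_eq_0) simp
  also have "(\<Sum>l<Suc n. (Cat * U ^ (l * (r + 1) + r)) $ n) =
      (\<Sum>l<Suc n. ballot n (int (Suc l) * (int r + 1)))"
    unfolding Cat_U_power_nth by (simp add: algebra_simps)
  also have "\<dots> = (\<Sum>l=1..Suc n. ballot n (int l * (int r + 1)))"
    by (rule sum.reindex_bij_witness[where i = "\<lambda>l. l - 1" and j = Suc]) auto
  finally show ?thesis by (simp add: tall_nodes_gf_def tree_gf_def)
qed

theorem corollary2p10:
  fixes n r :: nat
  shows "measure_pmf.expectation (pmf_of_set (plane_trees (n + 1))) (\<lambda>t. real (reduced_size r t)) =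
    1 / catalan n *
      (\<Sum>\<^sub>\<infinity>l::nat\<in>{1..}. real ((2 * n) ichoose (int n + 1 - int l * (int r + 1)))
                       - real ((2 * n) ichoose (int n - int l * (int r + 1))))"
proof -
  have zero: "ballot n (int l * (int r + 1)) = 0" if "l \<in> {1..} - {1..Suc n}" for l
  proof -
    from that have "int n + 1 < int l" by auto
    moreover have "int l * 1 \<le> int l * (int r + 1)" by (rule mult_left_mono) auto
    ultimately have "int n + 1 < int l * (int r + 1)" by linarith
    then show ?thesis by (simp add: ballot_def int_choose_def)
  qed
  have "(\<Sum>\<^sub>\<infinity>l::nat\<in>{1..}. ballot n (int l * (int r + 1))) =
      (\<Sum>\<^sub>\<infinity>l::nat\<in>{1..Suc n}. ballot n (int l * (int r + 1)))"
    using zero by (intro infsum_cong_neutral) auto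
  also have "\<dots> = (\<Sum>l=1..Suc n. ballot n (int l * (int r + 1)))"
    by (rule infsum_finite) simp
  finally have infsum: "(\<Sum>\<^sub>\<infinity>l::nat\<in>{1..}. ballot n (int l * (int r + 1))) =
      (\<Sum>t\<in>plane_trees (Suc n). real (tall_nodes r t))"
    by (simp only: sum_tall_nodes)
  have "measure_pmf.expectation (pmf_of_set (plane_trees (Suc n))) (\<lambda>t. real (reduced_size r t)) =
      (\<Sum>t\<in>plane_trees (Suc n). real (tall_nodes r t)) / catalan n"
    by (simp add: integral_pmf_of_set finite_plane_trees plane_trees_nonempty
        reduced_size_eq_tall_nodes card_plane_trees)
  then show ?thesis
    by (simp flip: infsum add: ballot_def)
qed

end
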